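(* Let $f:\mathbb{R}^n\to\mathbb{R}$ be continuously differentiable. Then the random-permutations cyclic coordinate descent method is approximated by subgradient trajectories of $f$.
   Context: Notation: $\mathbb{N}=\{0,1,2,\ldots\}$; $\|\cdot\|$ is the norm induced by an inner product on $\mathbb{R}^n$; $e_i$ is the $i$th vector of the canonical basis of $\mathbb{R}^n$; $\nabla_i f(x):=[\nabla f(x)]_i\,e_i$, where $[\nabla f(x)]_i$ is the $i$th entry of $\nabla f(x)$; $\lfloor\cdot\rfloor$ is the floor function. Random-permutations cyclic coordinate descent method: given a step size $\alpha>0$, choose $x_0\in\mathbb{R}^n$. For $k=0,1,\ldots$: choose an arbitrary permutation $\sigma^k$ of $\{1,\ldots,n\}$; set $x_{k,0}=x_k$; for $i=1,\ldots,n$ set $x_{k,i}=x_{k,i-1}-\alpha\nabla_{\sigma^k_i}f(x_{k,i-1})$; then set $x_{k+1}=x_{k,n}$. For $\alpha>0$, $X_0\subset\mathbb{R}^n$, $\bar{k}\in\mathbb{N}$, let $\mathcal{M}(f,\alpha,X_0,\bar{k})$ be the set of all sequences $(x_k)_{k\in\mathbb{N}}$ generated by this algorithm with step size $\alpha$ (over all initial points and permutations) such that $x_{\bar{k}}\in X_0$. The method is approximated by subgradient trajectories of $f$ if there exists $c>0$ such that for any compact sets $X_0,X_1\subset\mathbb{R}^n$ there exists $T>0$ such that for all $\epsilon>0$ there exists $\bar{\alpha}>0$ such that for all $\alpha\in(0,\bar{\alpha}]$, $\bar{k}\in\mathbb{N}$, and $(x_k)_{k\in\mathbb{N}}\in\mathcal{M}(f,\alpha,X_0,\bar{k})$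 for which $x_0,\ldots,x_{\bar{k}}\in X_1$, there exists an absolutely continuous function $x:[0,T]\to\mathbb{R}^n$ such that $x'(t)\in -c\,\partial f(x(t))$ for almost every $t\in[0,T]$, $x(0)\in X_0$, and $\|x_k-x((k-\bar{k})\alpha)\|\leqslant\epsilon$ for $k=\bar{k},\ldots,\bar{k}+\lfloor T/\alpha\rfloor$. Here $\partial f$ is the Clarke subdifferential, which for continuously differentiable $f$ is $\partial f(x)=\{\nabla f(x)\}$. *)

theory Defs
  imports "HOL-Analysis.Analysis"
begin

section \<open>Inner products on \<open>\<real>\<^sup>n\<close>\<close>

text \<open>
  The inner product is arbitrary. The norm, the gradient and the Clarke subdifferential are all
  taken with respect to it; the Euclidean setting is the instance \<open>(\<bullet>)\<close>.
\<close>

definition is_inner_product :: "(real ^ 'n \<Rightarrow> real ^ 'n \<Rightarrow> real) \<Rightarrow> bool" where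
  "is_inner_product ip \<longleftrightarrow>
     bilinear ip \<and> (\<forall>u v. ip u v = ip v u) \<and> (\<forall>v. v \<noteq> 0 \<longrightarrow> ip v v > 0)"

definition induced_norm :: "(real ^ 'n \<Rightarrow> real ^ 'n \<Rightarrow> real) \<Rightarrow> real ^ 'n \<Rightarrow> real" where
  "induced_norm ip v = sqrt (ip v v)"

section \<open>Differentiability and subdifferentials\<close>

definition continuously_differentiable :: "(real ^ 'n \<Rightarrow> real) \<Rightarrow> bool" where
  "continuously_differentiable f \<longleftrightarrow>
     (\<exists>f' :: real ^ 'n \<Rightarrow> (real ^ 'n) \<Rightarrow>\<^sub>L real.
        (\<forall>x. (f has_derivative blinfun_apply (f' x)) (at x)) \<and> continuous_on UNIV f')"

definition gradient ::
    "(real ^ 'n \<Rightarrow> real ^ 'n \<Rightarrow> real) \<Rightarrow> (real ^ 'n \<Rightarrow> real) \<Rightarrow> real ^ 'n \<Rightarrow> real ^ 'n" where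
  "gradient ip f x = (THE g. (f has_derivative (\<lambda>h. ip g h)) (at x))"

definition clarke_dir_deriv :: "(real ^ 'n \<Rightarrow> real) \<Rightarrow> real ^ 'n \<Rightarrow> real ^ 'n \<Rightarrow> ereal" where
  "clarke_dir_deriv f x h =
     Limsup (nhds x \<times>\<^sub>F at_right 0) (\<lambda>(y, t). ereal ((f (y + t *\<^sub>R h) - f y) / t))"

definition clarke_subdifferential ::
    "(real ^ 'n \<Rightarrow> real ^ 'n \<Rightarrow> real) \<Rightarrow> (real ^ 'n \<Rightarrow> real) \<Rightarrow> real ^ 'n \<Rightarrow> (real ^ 'n) set" where
  "clarke_subdifferential ip f x = {s. \<forall>h. ereal (ip s h) \<le> clarke_dir_deriv f x h}"

section \<open>Random-permutations cyclic coordinate descent\<close>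

definition coord_gradient ::
    "(real ^ 'n \<Rightarrow> real ^ 'n \<Rightarrow> real) \<Rightarrow> (real ^ 'n \<Rightarrow> real) \<Rightarrow> 'n \<Rightarrow> real ^ 'n \<Rightarrow> real ^ 'n" where
  "coord_gradient ip f i x = axis i (gradient ip f x $ i)"

text \<open>\<open>cycle_iterate ip f \<alpha> \<sigma> x\<^sub>k i\<close> is the inner iterate \<open>x\<^bsub>k,i\<^esub>\<close>.\<close>

primrec cycle_iterate ::
    "(real ^ 'n \<Rightarrow> real ^ 'n \<Rightarrow> real) \<Rightarrow> (real ^ 'n \<Rightarrow> real) \<Rightarrow> real \<Rightarrow> (nat \<Rightarrow> 'n) \<Rightarrow>
     real ^ 'n \<Rightarrow> nat \<Rightarrow> real ^ 'n" where
  "cycle_iterate ip f \<alpha> \<sigma> x 0 = x"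
| "cycle_iterate ip f \<alpha> \<sigma> x (Suc i) =
     cycle_iterate ip f \<alpha> \<sigma> x i
       - \<alpha> *\<^sub>R coord_gradient ip f (\<sigma> (Suc i)) (cycle_iterate ip f \<alpha> \<sigma> x i)"

text \<open>
  The coordinates are indexed by the type \<open>'n\<close>, which carries no order, so a permutation of
  \<open>{1,\<dots>,n}\<close> becomes an enumeration \<open>{1..CARD('n)} \<rightarrow> 'n\<close> of the coordinates.
\<close>

definition rpccd_sequences ::
    "(real ^ 'n \<Rightarrow> real ^ 'n \<Rightarrow> real) \<Rightarrow> (real ^ 'n \<Rightarrow> real) \<Rightarrow> real \<Rightarrow> (real ^ 'n) set \<Rightarrow> nat \<Rightarrow>
     (nat \<Rightarrow> real ^ 'n) set" where
  "rpccd_sequences ip f \<alpha> X0 kbar =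
     {x. (\<exists>\<sigma> :: nat \<Rightarrow> nat \<Rightarrow> 'n.
            (\<forall>k. bij_betw (\<sigma> k) {1..CARD('n)} UNIV) \<and>
            (\<forall>k. x (Suc k) = cycle_iterate ip f \<alpha> (\<sigma> k) (x k) CARD('n))) \<and>
         x kbar \<in> X0}"

section \<open>Approximation by subgradient trajectories\<close>

definition absolutely_continuous_fun_on ::
    "real set \<Rightarrow> (real \<Rightarrow> 'a::real_normed_vector) \<Rightarrow> bool" where
  "absolutely_continuous_fun_on S x \<longleftrightarrow>
     (\<forall>\<epsilon>>0. \<exists>\<delta>>0. \<forall>(m::nat) (a::nat \<Rightarrow> real) b.
        (\<forall>j<m. a j \<le> b j \<and> {a j..b j} \<subseteq> S) \<and>
        disjoint_family_on (\<lambda>j. {a j<..<b j}) {..<m} \<and>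
        (\<Sum>j<m. b j - a j) < \<delta>
        \<longrightarrow> (\<Sum>j<m. norm (x (b j) - x (a j))) < \<epsilon>)"

definition subgradient_trajectory ::
    "(real ^ 'n \<Rightarrow> real ^ 'n \<Rightarrow> real) \<Rightarrow> (real ^ 'n \<Rightarrow> real) \<Rightarrow> real \<Rightarrow> real \<Rightarrow>
     (real \<Rightarrow> real ^ 'n) \<Rightarrow> bool" where
  "subgradient_trajectory ip f c T x \<longleftrightarrow>
     absolutely_continuous_fun_on {0..T} x \<and>
     (AE t in lebesgue. t \<in> {0..T} \<longrightarrow>
        (\<exists>s\<in>clarke_subdifferential ip f (x t).
           (x has_vector_derivative - (c *\<^sub>R s)) (at t within {0..T})))"

text \<open>The argument \<open>M\<close> stands for the map \<open>(\<alpha>, X\<^sub>0, kbar) \<mapsto> \<M>(f, \<alpha>, X\<^sub>0, kbar)\<close> of a method.\<close>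

definition approximated_by_subgradient_trajectories ::
    "(real ^ 'n \<Rightarrow> real ^ 'n \<Rightarrow> real) \<Rightarrow> (real ^ 'n \<Rightarrow> real) \<Rightarrow>
     (real \<Rightarrow> (real ^ 'n) set \<Rightarrow> nat \<Rightarrow> (nat \<Rightarrow> real ^ 'n) set) \<Rightarrow> bool" where
  "approximated_by_subgradient_trajectories ip f M \<longleftrightarrow>
     (\<exists>c>0. \<forall>X0 X1. compact X0 \<and> compact X1 \<longrightarrow>
        (\<exists>T>0. \<forall>\<epsilon>>0. \<exists>\<alpha>bar>0. \<forall>\<alpha>\<in>{0<..\<alpha>bar}. \<forall>kbar. \<forall>xs\<in>M \<alpha> X0 kbar.
           (\<forall>k\<le>kbar. xs k \<in> X1) \<longrightarrow>
           (\<exists>x. subgradient_trajectory ip f c T x \<and> x 0 \<in> X0 \<and>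
              (\<forall>k\<in>{kbar..kbar + nat \<lfloor>T / \<alpha>\<rfloor>}.
                 induced_norm ip (xs k - x (real (k - kbar) * \<alpha>)) \<le> \<epsilon>))))"

end

theory Submission
  imports Defs "HOL-Complex_Analysis.Great_Picard"
begin

section \<open>The gradient with respect to an inner product\<close>

text \<open>A cycle updates every coordinate exactly once. If all partial derivatives were evaluated
  at the start \<open>x\<close> of the cycle, then in any order the updates would add up to the
  gradient step - \<alpha> \<open>gradient ip f x\<close>. The inner iterates stay within n \<alpha>
  M of \<open>x\<close>, where M bounds the gradient on a ball, so by uniform continuity there the
  error of the cycle is \<alpha> times a quantity that vanishes with \<alpha>
  (\<open>cycle_iterate_displacement\<close>, \<open>cycle_iterate_consistent\<close>). The outer
  iterates are thus inexact Euler steps for x' = - grad f(x), and c = 1 works.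

  The gradient is merely continuous, so a Gronwall estimate against a given solution is out of
  reach. Compactness replaces it. If the claim failed for some \<epsilon>, there would be failing
  sequences with step sizes tending to 0. Their piecewise linear interpolations on [0,T] are bounded
  and share a Lipschitz constant, hence by Arzela-Ascoli a subsequence converges uniformly; the
  limit solves the differential equation and starts in the closed set X0
  (\<open>inexact_euler_limit\<close>). Members late in the subsequence are then \<epsilon>-close to
  that solution, a contradiction (\<open>rpccd_subsequence_approximated\<close>). The index kbar may
  vary along the subsequence, which gives uniformity in kbar.

  All estimates use the Euclidean norm. The inner product enters through the gradient, which is a
  Clarke subgradient (\<open>gradient_in_clarke_subdifferential\<close>), and through a final
  comparison of norms.\<close>

lemma is_inner_product_bilinear: "is_inner_product ip \<Longrightarrow> bilinear ip"
  by (simp add: is_inner_product_def)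

lemma is_inner_product_nondegenerate:
  assumes "is_inner_product ip" "\<And>h. ip u h = ip v h"
  shows "u = v"
proof (rule ccontr)
  assume "u \<noteq> v"
  then have "ip (u - v) (u - v) > 0"
    using assms(1) by (simp add: is_inner_product_def)
  then show False
    using assms by (simp add: bilinear_lsub[OF is_inner_product_bilinear])
qed

text \<open>Riesz representation with a linear solution operator. The map from a vector to the
  values of its functional on the standard basis is injective by definiteness, hence bijective, and
  \<open>R\<close> is its inverse. That \<open>R\<close> is one fixed linear map is what later makes
  the gradient continuous.\<close>

lemma inner_product_riesz:
  fixes ip :: "real ^ 'n \<Rightarrow> real ^ 'n \<Rightarrow> real"
  assumes "is_inner_product ip"
  obtains R where "linear R" "\<And>l h. linear l \<Longrightarrow> ip (R (\<chi> j. l (axis j 1))) h = l h"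
proof -
  have lin: "linear (ip u)" "linear (\<lambda>u. ip u v)" for u v
    using is_inner_product_bilinear[OF assms] by (auto simp: bilinear_def)
  define \<Phi> where "\<Phi> u = (\<chi> j. ip u (axis j 1))" for u
  have agree: "l = l'" if "linear l" "linear l'" "\<And>j. l (axis j 1) = l' (axis j (1::real))"
    for l l' :: "real ^ 'n \<Rightarrow> real"
    using that by (intro linear_eq_stdbasis) (auto simp: Basis_vec_def)
  have "linear \<Phi>"
    unfolding \<Phi>_def using linear_add[OF lin(2)] linear_scale[OF lin(2)]
    by (intro linearI) (simp_all add: vec_eq_iff)
  moreover have "inj \<Phi>"
  proof (rule injI)
    fix u v assume "\<Phi> u = \<Phi> v"
    then have "ip u = ip v"
      by (intro agree lin) (simp add: \<Phi>_def vec_eq_iff)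
    then show "u = v"
      by (intro is_inner_product_nondegenerate[OF assms]) simp
  qed
  ultimately have "surj \<Phi>"
    by (rule linear_injective_imp_surjective) simp
  obtain R where R: "linear R" "R \<circ> \<Phi> = id"
    using linear_injective_left_inverse[OF \<open>linear \<Phi>\<close> \<open>inj \<Phi>\<close>] by blast
  show thesis
  proof
    fix l :: "real ^ 'n \<Rightarrow> real" and h assume "linear l"
    obtain u where u: "(\<chi> j. l (axis j 1)) = \<Phi> u"
      using \<open>surj \<Phi>\<close> by blast
    then have "ip u = l"
      by (intro agree lin \<open>linear l\<close>) (simp add: \<Phi>_def vec_eq_iff)
    moreover have "R (\<Phi> u) = u"
      using R(2) by (simp add: fun_eq_iff)
    ultimately show "ip (R (\<chi> j. l (axis j 1))) h = l h"
      by (simp add: u)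
  qed (rule R)
qed

lemma gradient_eqI:
  assumes "is_inner_product ip" "(f has_derivative ip g) (at x)"
  shows "gradient ip f x = g"
  unfolding gradient_def
proof (rule the_equality)
  fix g' assume "(f has_derivative ip g') (at x)"
  then have "ip g' = ip g"
    using assms(2) by (rule has_derivative_unique)
  then show "g' = g"
    by (intro is_inner_product_nondegenerate[OF assms(1)]) simp
qed (use assms in simp)

text \<open>The gradient is the fixed linear map \<open>R\<close> applied to the vector of partial
  derivatives, so it inherits their continuity.\<close>

lemma
  fixes f :: "real ^ 'n \<Rightarrow> real"
  assumes "is_inner_product ip" "continuously_differentiable f"
  shows has_derivative_gradient: "(f has_derivative ip (gradient ip f x)) (at x)"
    and continuous_on_gradient: "continuous_on S (gradient ip f)"
proof -
  obtain f' :: "real ^ 'n \<Rightarrow> (real ^ 'n) \<Rightarrow>\<^sub>L real"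
    where f': "\<And>x. (f has_derivative blinfun_apply (f' x)) (at x)" and cont: "continuous_on UNIV f'"
    using assms(2) unfolding continuously_differentiable_def by blast
  obtain R where R: "linear R" "\<And>l h. linear l \<Longrightarrow> ip (R (\<chi> j. l (axis j 1))) h = l h"
    using inner_product_riesz[OF assms(1)] by blast
  have eq: "ip (R (\<chi> j. f' x (axis j 1))) = f' x" for x
    using R(2)[of "blinfun_apply (f' x)"]
    by (simp add: fun_eq_iff blinfun.bounded_linear_right bounded_linear.linear)
  then have grad: "gradient ip f x = R (\<chi> j. f' x (axis j 1))" for x
    by (intro gradient_eqI assms(1)) (simp add: f')
  show "(f has_derivative ip (gradient ip f x)) (at x)"
    by (simp add: grad eq f')
  have "continuous_on S (\<lambda>x. R (\<chi> j. f' x (axis j 1)))"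
    by (intro linear_continuous_on_compose[OF _ R(1)] continuous_intros
        continuous_on_subset[OF cont subset_UNIV])
  then show "continuous_on S (gradient ip f)"
    by (simp add: grad [abs_def])
qed

text \<open>Restricting the upper limit to the constant base point y = x can only lower it, and
  there it equals the ordinary directional derivative \<open>ip g h\<close>. A trajectory needs only
  this membership.\<close>

lemma gradient_in_clarke_subdifferential:
  assumes "(f has_derivative ip g) (at x)" and "bilinear ip"
  shows "g \<in> clarke_subdifferential ip f x"
  unfolding clarke_subdifferential_def
proof (intro CollectI allI)
  fix h
  let ?q = "\<lambda>(y, t). ereal ((f (y + t *\<^sub>R h) - f y) / t)"
  have "((\<lambda>t. f (x + t *\<^sub>R h)) has_derivative (\<lambda>t. ip g (t *\<^sub>R h))) (at 0)"
    by (rule has_derivative_compose[where g = f])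
      (use assms(1) in \<open>auto intro!: derivative_eq_intros\<close>)
  then have "((\<lambda>t. f (x + t *\<^sub>R h)) has_field_derivative ip g h) (at 0)"
    by (simp add: bilinear_rmul[OF assms(2)] has_field_derivative_def mult.commute[of _ "ip g h"])
  then have "((\<lambda>t. (f (x + t *\<^sub>R h) - f x) / t) \<longlongrightarrow> ip g h) (at_right 0)"
    by (simp add: has_field_derivative_iff filterlim_at_split)
  then have "((\<lambda>t. ?q (x, t)) \<longlongrightarrow> ereal (ip g h)) (at_right 0)"
    by simp
  then have "ereal (ip g h) = Limsup (at_right 0) (\<lambda>t. ?q (x, t))"
    by (intro lim_imp_Limsup[symmetric]) (auto simp: trivial_limit_at_right_real)
  also have "\<dots> \<le> Limsup (filtermap (Pair x) (at_right 0)) ?q"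
    by (rule Limsup_filtermap_ge)
  also have "\<dots> \<le> Limsup (nhds x \<times>\<^sub>F at_right 0) ?q"
  proof -
    have "filtermap (Pair x) (at_right 0) \<le> nhds x \<times>\<^sub>F at_right 0"
      using filterlim_Pair[OF tendsto_const filterlim_ident] by (simp add: filterlim_def)
    then show ?thesis
      unfolding Limsup_def by (intro INF_superset_mono) (auto simp: le_filter_def)
  qed
  finally show "ereal (ip g h) \<le> clarke_dir_deriv f x h"
    by (simp add: clarke_dir_deriv_def)
qed

lemma induced_norm_bounded:
  fixes ip :: "real ^ 'n \<Rightarrow> real ^ 'n \<Rightarrow> real"
  assumes "bilinear ip"
  obtains B where "B > 0" "\<And>v. induced_norm ip v \<le> B * norm v"
proof -
  obtain B where B: "B > 0" "\<And>u v. norm (ip u v) \<le> B * norm u * norm v"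
    using bilinear_bounded_pos[OF assms] by blast
  have "induced_norm ip v \<le> sqrt B * norm v" for v
  proof -
    have "ip v v \<le> B * (norm v)\<^sup>2"
      using B(2)[of v v] by (simp add: power2_eq_square mult.assoc)
    then have "sqrt (ip v v) \<le> sqrt (B * (norm v)\<^sup>2)"
      by (rule real_sqrt_le_mono)
    then show ?thesis
      by (simp add: induced_norm_def real_sqrt_mult)
  qed
  then show thesis
    using that[of "sqrt B"] B(1) by simp
qed

section \<open>Interpolating polygons\<close>

text \<open>This is the fraction of the cell [k, k+1] that lies to the left of
  \<open>u\<close>.\<close>

definition ramp :: "real \<Rightarrow> nat \<Rightarrow> real" where
  "ramp u k = max 0 (min 1 (u - real k))"

text \<open>Writing the interpolation with ramps avoids a case distinction on the cell containing \<open>u\<close>.\<close>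

definition polygon :: "(nat \<Rightarrow> 'a::real_vector) \<Rightarrow> nat \<Rightarrow> real \<Rightarrow> 'a" where
  "polygon x K u = x 0 + (\<Sum>k<K. ramp u k *\<^sub>R (x (Suc k) - x k))"

lemma sum_ramp: "0 \<le> u \<Longrightarrow> (\<Sum>k<K. ramp u k) = min u (real K)"
  by (induction K) (auto simp: ramp_def min_def max_def)

lemma ramp_mono: "u \<le> v \<Longrightarrow> ramp u k \<le> ramp v k"
  by (auto simp: ramp_def min_def max_def)

text \<open>All ramps are monotone in \<open>u\<close>, so the differences have one sign and the
  absolute values sum without cancellation.\<close>

lemma sum_abs_ramp_diff:
  assumes "u \<in> {0..real K}" "v \<in> {0..real K}"
  shows "(\<Sum>k<K. \<bar>ramp u k - ramp v k\<bar>) = \<bar>u - v\<bar>"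
  using assms
proof (induction u v rule: linorder_wlog)
  case (le u v)
  then have "(\<Sum>k<K. \<bar>ramp u k - ramp v k\<bar>) = (\<Sum>k<K. ramp v k - ramp u k)"
    by (intro sum.cong refl) (simp add: ramp_mono)
  with le show ?case
    by (simp add: sum_subtractf sum_ramp)
qed (simp add: abs_minus_commute)

text \<open>A ramp changes only if the stretch between \<open>u\<close> and \<open>v\<close> meets
  its cell. This localises the increments that matter for a difference quotient.\<close>

lemma ramp_neq_imp_close: "ramp u k \<noteq> ramp v k \<Longrightarrow> \<bar>real k - u\<bar> \<le> \<bar>u - v\<bar> + 1"
  by (auto simp: ramp_def min_def max_def split: if_splits)

lemma polygon_of_nat:
  assumes "j \<le> K"
  shows "polygon x K (real j) = x j"
proof -
  have "(\<Sum>k<K. ramp (real j) k *\<^sub>R (x (Suc k) - x k)) = (\<Sum>k<j. x (Suc k) - x k)"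
    by (rule sum.mono_neutral_cong_right) (use assms in \<open>auto simp: ramp_def\<close>)
  then show ?thesis
    by (simp add: polygon_def sum_lessThan_telescope)
qed

text \<open>The ramp differences sum to u - v, so \<open>w\<close> can be subtracted inside each
  summand, and their absolute values sum to |u - v|. Only cells met between \<open>u\<close> and
  \<open>v\<close> have to satisfy the bound; \<open>w\<close> = 0 gives the Lipschitz
  estimate.\<close>

lemma polygon_diff_bound:
  fixes x :: "nat \<Rightarrow> 'a::real_normed_vector"
  assumes uv: "u \<in> {0..real K}" "v \<in> {0..real K}"
    and bound: "\<And>k. k < K \<Longrightarrow> ramp u k \<noteq> ramp v k \<Longrightarrow> norm (x (Suc k) - x k - w) \<le> B"
  shows "norm (polygon x K u - polygon x K v - (u - v) *\<^sub>R w) \<le> \<bar>u - v\<bar> * B"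
proof -
  have "(u - v) *\<^sub>R w = (\<Sum>k<K. (ramp u k - ramp v k) *\<^sub>R w)"
    using uv by (simp add: sum_subtractf sum_ramp flip: scaleR_sum_left)
  then have "polygon x K u - polygon x K v - (u - v) *\<^sub>R w =
      (\<Sum>k<K. (ramp u k - ramp v k) *\<^sub>R (x (Suc k) - x k - w))"
    by (simp add: polygon_def sum_subtractf scaleR_diff_left scaleR_diff_right)
  also have "norm \<dots> \<le> (\<Sum>k<K. \<bar>ramp u k - ramp v k\<bar> * B)"
  proof (rule sum_norm_le)
    fix k assume "k \<in> {..<K}"
    then show "norm ((ramp u k - ramp v k) *\<^sub>R (x (Suc k) - x k - w)) \<le> \<bar>ramp u k - ramp v k\<bar> * B"
      using bound[of k] by (cases "ramp u k = ramp v k") (auto intro!: mult_left_mono)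
  qed
  also have "\<dots> = \<bar>u - v\<bar> * B"
    by (simp add: sum_abs_ramp_diff[OF uv] flip: sum_distrib_right)
  finally show ?thesis .
qed

lemma polygon_lipschitz:
  fixes x :: "nat \<Rightarrow> 'a::real_normed_vector"
  assumes "u \<in> {0..real K}" "v \<in> {0..real K}"
    and "\<And>k. k < K \<Longrightarrow> norm (x (Suc k) - x k) \<le> B"
  shows "norm (polygon x K u - polygon x K v) \<le> \<bar>u - v\<bar> * B"
  using polygon_diff_bound[of u K v x 0 B] assms by simp

section \<open>Limits of inexact Euler polygons\<close>

text \<open>No Lipschitz condition on \<open>G\<close> is available, so the trajectory is obtained as a limit point of the
  polygons, as in Peano's theorem. The differential equation is read off locally:
  near time \<open>t\<close> all increments are close to \<open>- \<alpha> *\<^sub>R G (y t)\<close>, so no integral is needed.\<close>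

lemma inexact_euler_limit:
  fixes G :: "'a::euclidean_space \<Rightarrow> 'a" and X :: "nat \<Rightarrow> nat \<Rightarrow> 'a" and \<alpha> :: "nat \<Rightarrow> real"
  assumes contG: "continuous_on UNIV G"
    and pos: "\<And>m. 0 < \<alpha> m" and lim: "\<alpha> \<longlonglongrightarrow> 0"
    and horizon: "\<And>m. T \<le> real (K m) * \<alpha> m"
    and init: "\<And>m. norm (X m 0) \<le> B"
    and incr: "\<And>m k. k < K m \<Longrightarrow> norm (X m (Suc k) - X m k) \<le> \<alpha> m * L"
    and consistent: "\<And>e. 0 < e \<Longrightarrow> \<forall>\<^sub>F m in sequentially. \<forall>k<K m.
        norm (X m (Suc k) - X m k + \<alpha> m *\<^sub>R G (X m k)) \<le> \<alpha> m * e"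
    and "0 \<le> L" "0 \<le> T"
  obtains y r where "strict_mono r"
    and "\<And>t. t \<in> {0..T} \<Longrightarrow> (y has_vector_derivative - G (y t)) (at t within {0..T})"
    and "L-lipschitz_on {0..T} y"
    and "(\<lambda>m. X (r m) 0) \<longlonglongrightarrow> y 0"
    and "\<And>e. 0 < e \<Longrightarrow> \<forall>\<^sub>F m in sequentially. \<forall>k. real k * \<alpha> (r m) \<le> T \<longrightarrow>
          norm (X (r m) k - y (real k * \<alpha> (r m))) < e"
proof -
  define Y where "Y m t = polygon (X m) (K m) (t / \<alpha> m)" for m t
  have scaled: "t / \<alpha> m \<in> {0..real (K m)}" if "t \<in> {0..T}" for t m
    using that horizon[of m] pos[of m] by (auto simp: field_simps)
  have Y_lipschitz: "norm (Y m s - Y m t) \<le> L * \<bar>s - t\<bar>" if "s \<in> {0..T}" "t \<in> {0..T}" for m s t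
  proof -
    have "norm (Y m s - Y m t) \<le> \<bar>s / \<alpha> m - t / \<alpha> m\<bar> * (\<alpha> m * L)"
      unfolding Y_def using that by (intro polygon_lipschitz scaled incr)
    also have "\<dots> = L * \<bar>s - t\<bar>"
      using pos[of m] by (simp flip: diff_divide_distrib)
    finally show ?thesis .
  qed
  have Y_grid: "Y m (real k * \<alpha> m) = X m k" if "real k * \<alpha> m \<le> T" for m k
  proof -
    have "k \<le> K m"
      using order_trans[OF that horizon[of m]] pos[of m] by simp
    then show ?thesis
      using pos[of m] by (simp add: Y_def polygon_of_nat)
  qed
  have Y0: "Y m 0 = X m 0" for m
    using Y_grid[of 0 m] \<open>0 \<le> T\<close> by simp
  have Y_bound: "norm (Y m t) \<le> B + L * T" if "t \<in> {0..T}" for m t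
  proof -
    have "norm (Y m t) \<le> norm (Y m 0) + norm (Y m t - Y m 0)"
      using norm_triangle_ineq[of "Y m 0" "Y m t - Y m 0"] by simp
    also have "\<dots> \<le> B + L * \<bar>t - 0\<bar>"
      using init[of m] \<open>0 \<le> T\<close> that by (intro add_mono Y_lipschitz) (auto simp: Y0)
    also have "\<dots> \<le> B + L * T"
      using \<open>0 \<le> L\<close> that by (auto intro!: mult_left_mono)
    finally show ?thesis .
  qed
  \<comment> \<open>The common Lipschitz constant gives equicontinuity; L + 1 in place of L allows
    for L = 0.\<close>
  obtain y r where r: "strict_mono (r :: nat \<Rightarrow> nat)" and
    conv: "\<And>e. 0 < e \<Longrightarrow> \<exists>N. \<forall>n t. n \<ge> N \<and> t \<in> {0..T} \<longrightarrow> norm (Y (r n) t - y t) < e"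
  proof (rule Arzela_Ascoli[of "{0..T}" Y "B + L * T"])
    fix t e :: real assume "t \<in> {0..T}" "0 < e"
    show "\<exists>d>0. \<forall>n s. s \<in> {0..T} \<and> norm (t - s) < d \<longrightarrow> norm (Y n t - Y n s) < e"
    proof (intro exI[of _ "e / (L + 1)"] conjI allI impI)
      show "0 < e / (L + 1)"
        using \<open>0 < e\<close> \<open>0 \<le> L\<close> by simp
      fix n s assume s: "s \<in> {0..T} \<and> norm (t - s) < e / (L + 1)"
      have "norm (Y n t - Y n s) \<le> L * \<bar>t - s\<bar>"
        using s \<open>t \<in> {0..T}\<close> by (intro Y_lipschitz) auto
      also have "\<dots> \<le> (L + 1) * \<bar>t - s\<bar>"
        by (simp add: mult_right_mono)
      also have "\<dots> < e"
        using s \<open>0 \<le> L\<close> by (simp add: field_simps)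
      finally show "norm (Y n t - Y n s) < e" .
    qed
  qed (use Y_bound in auto)
  have Y_tendsto: "(\<lambda>m. Y (r m) t) \<longlonglongrightarrow> y t" if "t \<in> {0..T}" for t
    unfolding LIMSEQ_iff using conv that by blast
  have \<alpha>_tendsto: "(\<lambda>m. \<alpha> (r m)) \<longlonglongrightarrow> 0"
    using LIMSEQ_subseq_LIMSEQ[OF lim r] by (simp add: o_def)
  have y_lipschitz: "L-lipschitz_on {0..T} y"
  proof (rule lipschitz_onI)
    fix s t assume st: "s \<in> {0..T}" "t \<in> {0..T}"
    have "(\<lambda>m. norm (Y (r m) s - Y (r m) t)) \<longlonglongrightarrow> norm (y s - y t)"
      using st by (intro tendsto_intros Y_tendsto)
    then have "norm (y s - y t) \<le> L * \<bar>s - t\<bar>"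
      using Y_lipschitz[OF st] by (intro LIMSEQ_le_const2) auto
    then show "dist (y s) (y t) \<le> L * dist s t"
      by (simp add: dist_norm)
  qed (rule \<open>0 \<le> L\<close>)
  \<comment> \<open>The epsilon-delta form of the derivative ends in a non-strict inequality, so it
    suffices to prove it for the polygons \<open>Y (r m)\<close> and let \<open>m\<close> tend to
    infinity.\<close>
  have deriv: "(y has_vector_derivative - G (y t)) (at t within {0..T})" if t: "t \<in> {0..T}" for t
    unfolding has_vector_derivative_def has_derivative_within_alt
  proof (intro conjI allI impI)
    show "bounded_linear (\<lambda>h. h *\<^sub>R - G (y t))"
      by (rule bounded_linear_scaleR_left)
    fix e :: real assume "0 < e"
    have "isCont G (y t)"
      using contG by (simp add: continuous_on_eq_continuous_at)
    then obtain d where "0 < d" and d: "\<And>z. norm (z - y t) < d \<Longrightarrow> norm (G z - G (y t)) < e / 2"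
      using \<open>0 < e\<close> unfolding continuous_at_eps_delta by (metis half_gt_zero dist_norm)
    \<comment> \<open>With |s - t| and the step size both below \<delta>, a relevant vertex is
      within 2 L \<delta> \<le> d/2 of \<open>Y (r m) t\<close>, which is within d/4 of
      \<open>y t\<close>; this leaves the vertex in the d-ball around \<open>y t\<close>.\<close>
    define \<delta> where "\<delta> = d / (4 * (L + 1))"
    have "0 < \<delta>"
      using \<open>0 < d\<close> \<open>0 \<le> L\<close> by (simp add: \<delta>_def)
    have L\<delta>: "L * \<delta> \<le> d / 4"
      using \<open>0 < d\<close> \<open>0 \<le> L\<close> by (simp add: \<delta>_def field_simps)
    have "norm (y s - y t - (s - t) *\<^sub>R - G (y t)) \<le> e * norm (s - t)"
      if s: "s \<in> {0..T}" and close: "norm (s - t) < \<delta>" for s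
    proof -
      have "\<forall>\<^sub>F m in sequentially. \<alpha> (r m) < \<delta>"
        using order_tendstoD(2)[OF \<alpha>_tendsto \<open>0 < \<delta>\<close>] .
      moreover have "\<forall>\<^sub>F m in sequentially. norm (Y (r m) t - y t) < d / 4"
        using tendstoD[OF Y_tendsto[OF t], of "d / 4"] \<open>0 < d\<close> by (simp add: dist_norm)
      moreover have "\<forall>\<^sub>F m in sequentially. \<forall>k<K (r m).
          norm (X (r m) (Suc k) - X (r m) k + \<alpha> (r m) *\<^sub>R G (X (r m) k)) \<le> \<alpha> (r m) * (e / 2)"
        using eventually_subseq[OF r consistent[of "e / 2"]] \<open>0 < e\<close> by simp
      ultimately have "\<forall>\<^sub>F m in sequentially.
          norm (Y (r m) s - Y (r m) t - (s - t) *\<^sub>R - G (y t)) \<le> e * norm (s - t)"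
      proof eventually_elim
        case (elim m)
        let ?a = "\<alpha> (r m)" and ?x = "X (r m)"
        have a: "0 < ?a" by (rule pos)
        \<comment> \<open>Half of \<open>e\<close> pays for the inexactness of the step, the other
          half for replacing the gradient field at the vertex by its value at
          \<open>y t\<close>.\<close>
        have "norm (?x (Suc k) - ?x k - - ?a *\<^sub>R G (y t)) \<le> ?a * e"
          if k: "k < K (r m)" and moved: "ramp (s / ?a) k \<noteq> ramp (t / ?a) k" for k
        proof -
          have "norm (?x k - Y (r m) t) = norm (polygon ?x (K (r m)) (real k) - Y (r m) t)"
            using k by (simp add: polygon_of_nat)
          also have "\<dots> \<le> \<bar>real k - t / ?a\<bar> * (?a * L)"
            unfolding Y_def using k t by (intro polygon_lipschitz scaled incr) auto
          also have "\<dots> \<le> (\<bar>t / ?a - s / ?a\<bar> + 1) * (?a * L)"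
            using ramp_neq_imp_close[OF moved[symmetric]] a \<open>0 \<le> L\<close>
            by (intro mult_right_mono) auto
          also have "\<dots> = L * (\<bar>s - t\<bar> + ?a)"
            using a by (simp add: field_simps abs_minus_commute flip: diff_divide_distrib)
          also have "\<dots> \<le> L * (\<delta> + \<delta>)"
            using close elim(1) \<open>0 \<le> L\<close> by (intro mult_left_mono) auto
          also have "\<dots> \<le> d / 2"
            using L\<delta> by (simp add: algebra_simps)
          finally have "norm (?x k - y t) < d"
            using elim(2) norm_triangle_ineq[of "?x k - Y (r m) t" "Y (r m) t - y t"] \<open>0 < d\<close> by simp
          then have "norm (?a *\<^sub>R (G (?x k) - G (y t))) \<le> ?a * (e / 2)"
            using d[of "?x k"] a by simp
          then have "norm ((?x (Suc k) - ?x k + ?a *\<^sub>R G (?x k)) - ?a *\<^sub>R (G (?x k) - G (y t)))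
              \<le> ?a * (e / 2) + ?a * (e / 2)"
            using elim(3) k by (intro order_trans[OF norm_triangle_ineq4] add_mono) auto
          moreover have "?x (Suc k) - ?x k - - ?a *\<^sub>R G (y t) =
              (?x (Suc k) - ?x k + ?a *\<^sub>R G (?x k)) - ?a *\<^sub>R (G (?x k) - G (y t))"
            by (simp add: algebra_simps)
          ultimately show ?thesis
            by (metis distrib_left field_sum_of_halves)
        qed
        then have "norm (Y (r m) s - Y (r m) t - (s / ?a - t / ?a) *\<^sub>R (- ?a *\<^sub>R G (y t)))
            \<le> \<bar>s / ?a - t / ?a\<bar> * (?a * e)"
          unfolding Y_def using s t by (intro polygon_diff_bound scaled)
        then show ?case
          using a by (simp add: mult.commute flip: diff_divide_distrib)
      qed
      moreover have "(\<lambda>m. norm (Y (r m) s - Y (r m) t - (s - t) *\<^sub>R - G (y t)))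
          \<longlonglongrightarrow> norm (y s - y t - (s - t) *\<^sub>R - G (y t))"
        using s t by (intro tendsto_intros Y_tendsto)
      ultimately show ?thesis
        by (intro tendsto_upperbound) auto
    qed
    with \<open>0 < \<delta>\<close> show "\<exists>d>0. \<forall>s\<in>{0..T}. norm (s - t) < d \<longrightarrow>
        norm (y s - y t - (s - t) *\<^sub>R - G (y t)) \<le> e * norm (s - t)"
      by blast
  qed
  have uniform: "\<forall>\<^sub>F m in sequentially. \<forall>k. real k * \<alpha> (r m) \<le> T \<longrightarrow>
          norm (X (r m) k - y (real k * \<alpha> (r m))) < e" if e: "0 < e" for e
  proof -
    obtain N where N: "\<And>n t. n \<ge> N \<Longrightarrow> t \<in> {0..T} \<Longrightarrow> norm (Y (r n) t - y t) < e"
      using conv[OF e] by blast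
    show ?thesis
      using eventually_ge_at_top[of N]
    proof eventually_elim
      case (elim m)
      then show ?case
        using N[OF elim] Y_grid pos[of "r m"]
        by (metis atLeastAtMost_iff less_imp_le mult_nonneg_nonneg of_nat_0_le_iff)
    qed
  qed
  have "(\<lambda>m. X (r m) 0) \<longlonglongrightarrow> y 0"
    using Y_tendsto[of 0] \<open>0 \<le> T\<close> by (simp add: Y0)
  with that r deriv y_lipschitz uniform show thesis
    by blast
qed

section \<open>One cycle of coordinate descent\<close>

text \<open>Holds for the Euclidean norm; the coordinate axes need not be orthogonal for
  \<open>ip\<close>, which is one reason to estimate in \<open>norm\<close>.\<close>

lemma norm_axis_nth_le: "norm (axis i (v $ i) :: real ^ 'n) \<le> norm v"
proof -
  have "axis i (v $ i) = (v $ i) *\<^sub>R axis i (1 :: real)"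
    by (simp add: vec_eq_iff axis_def)
  then show ?thesis
    by (simp add: component_le_norm_cart)
qed

text \<open>The gradient is bounded only on a ball, so the induction on \<open>i\<close> must also
  keep the iterates inside it. The room for all \<open>n\<close> updates is reserved in
  advance.\<close>

lemma cycle_iterate_displacement:
  fixes x :: "real ^ 'n"
  assumes "\<And>z. norm z \<le> R \<Longrightarrow> norm (gradient ip f z) \<le> M"
    and "norm x + real n * (\<alpha> * M) \<le> R" "0 \<le> \<alpha>" "0 \<le> M" "i \<le> n"
  shows "norm (cycle_iterate ip f \<alpha> \<sigma> x i - x) \<le> real i * (\<alpha> * M)"
  using \<open>i \<le> n\<close>
proof (induction i)
  case (Suc i)
  let ?z = "cycle_iterate ip f \<alpha> \<sigma> x i"
  have IH: "norm (?z - x) \<le> real i * (\<alpha> * M)"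
    using Suc by simp
  have "real i * (\<alpha> * M) \<le> real n * (\<alpha> * M)"
    using Suc.prems assms by (intro mult_right_mono) auto
  then have "norm ?z \<le> R"
    using IH assms(2) norm_triangle_ineq[of x "?z - x"] by simp
  then have "norm (coord_gradient ip f (\<sigma> (Suc i)) ?z) \<le> M"
    unfolding coord_gradient_def using assms(1) norm_axis_nth_le order_trans by blast
  then have "norm (\<alpha> *\<^sub>R coord_gradient ip f (\<sigma> (Suc i)) ?z) \<le> \<alpha> * M"
    using \<open>0 \<le> \<alpha>\<close> by (simp add: mult_left_mono)
  then show ?case
    using IH norm_triangle_ineq4[of "?z - x" "\<alpha> *\<^sub>R coord_gradient ip f (\<sigma> (Suc i)) ?z"]
    by (simp add: algebra_simps)
qed simp

lemma cycle_iterate_eq_sum: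
  "cycle_iterate ip f \<alpha> \<sigma> x n =
     x - \<alpha> *\<^sub>R (\<Sum>i<n. coord_gradient ip f (\<sigma> (Suc i)) (cycle_iterate ip f \<alpha> \<sigma> x i))"
  by (induction n) (simp_all add: algebra_simps)

lemma sum_axis_nth: "(\<Sum>i\<in>UNIV. axis i (v $ i)) = (v :: real ^ 'n)"
  by (simp add: vec_eq_iff axis_def)

lemma axis_diff: "axis i (a - b) = axis i a - (axis i b :: 'a::group_add ^ 'n)"
  by (simp add: vec_eq_iff axis_def)

text \<open>Each coordinate is updated exactly once, so freezing the gradient at the start of the cycle
  turns the cycle into a full gradient step.\<close>

lemma cycle_iterate_consistent:
  fixes x :: "real ^ 'n"
  assumes "bij_betw \<sigma> {1..CARD('n)} UNIV" "0 \<le> \<alpha>"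
    and osc: "\<And>i. i < CARD('n) \<Longrightarrow>
        norm (gradient ip f (cycle_iterate ip f \<alpha> \<sigma> x i) - gradient ip f x) \<le> e"
  shows "norm (cycle_iterate ip f \<alpha> \<sigma> x CARD('n) - x + \<alpha> *\<^sub>R gradient ip f x)
      \<le> \<alpha> * (real CARD('n) * e)"
proof -
  let ?g = "gradient ip f" and ?z = "cycle_iterate ip f \<alpha> \<sigma> x"
  have "bij_betw Suc {..<CARD('n)} {1..CARD('n)}"
    by (simp add: bij_betw_def image_Suc_lessThan)
  then have "bij_betw (\<sigma> \<circ> Suc) {..<CARD('n)} UNIV"
    using assms(1) by (rule bij_betw_trans)
  then have "?g x = (\<Sum>i<CARD('n). axis (\<sigma> (Suc i)) (?g x $ \<sigma> (Suc i)))"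
    using sum.reindex_bij_betw[of "\<sigma> \<circ> Suc" "{..<CARD('n)}" UNIV "\<lambda>i. axis i (?g x $ i)"]
    by (simp add: sum_axis_nth)
  then have "?z CARD('n) - x + \<alpha> *\<^sub>R ?g x =
      - (\<alpha> *\<^sub>R (\<Sum>i<CARD('n). axis (\<sigma> (Suc i)) ((?g (?z i) - ?g x) $ \<sigma> (Suc i))))"
    by (simp add: cycle_iterate_eq_sum[where n = "CARD('n)"] coord_gradient_def sum_subtractf scaleR_diff_right axis_diff)
  moreover have "norm (\<Sum>i<CARD('n). axis (\<sigma> (Suc i)) ((?g (?z i) - ?g x) $ \<sigma> (Suc i)))
      \<le> real CARD('n) * e"
    using order_trans[OF norm_axis_nth_le osc] by (intro sum_norm_bound[THEN order_trans]) auto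
  ultimately show ?thesis
    using \<open>0 \<le> \<alpha>\<close> by (simp add: mult_left_mono)
qed

lemma rpccd_sequences_Suc:
  fixes x :: "nat \<Rightarrow> real ^ 'n"
  assumes "x \<in> rpccd_sequences ip f \<alpha> X0 kbar"
  shows "\<exists>\<sigma>. bij_betw \<sigma> {1..CARD('n)} UNIV \<and>
      x (Suc k) = cycle_iterate ip f \<alpha> \<sigma> (x k) CARD('n)"
proof -
  obtain \<sigma> where "\<forall>k. bij_betw (\<sigma> k) {1..CARD('n)} (UNIV :: 'n set)"
    and "\<forall>k. x (Suc k) = cycle_iterate ip f \<alpha> (\<sigma> k) (x k) CARD('n)"
    using assms unfolding rpccd_sequences_def by auto
  then show ?thesis
    by (intro exI[of _ "\<sigma> k"]) simp
qed

text \<open>The same induction with whole cycles as steps, with room reserved for \<open>K\<close>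
  cycles.\<close>

lemma rpccd_sequences_displacement:
  fixes x :: "nat \<Rightarrow> real ^ 'n"
  assumes grad: "\<And>z. norm z \<le> R \<Longrightarrow> norm (gradient ip f z) \<le> M"
    and x: "x \<in> rpccd_sequences ip f \<alpha> X0 kbar" and "0 \<le> \<alpha>" "0 \<le> M"
    and "norm (x kbar) + real K * (real CARD('n) * (\<alpha> * M)) \<le> R" "k \<le> K"
  shows "norm (x (kbar + k) - x kbar) \<le> real k * (real CARD('n) * (\<alpha> * M))"
  using \<open>k \<le> K\<close>
proof (induction k)
  case (Suc k)
  let ?s = "real CARD('n) * (\<alpha> * M)"
  have IH: "norm (x (kbar + k) - x kbar) \<le> real k * ?s"
    using Suc by simp
  have "real (Suc k) * ?s \<le> real K * ?s"
    using Suc.prems assms by (intro mult_right_mono) auto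
  then have "norm (x (kbar + k)) + ?s \<le> R"
    using IH assms(5) norm_triangle_ineq[of "x kbar" "x (kbar + k) - x kbar"]
    by (simp add: algebra_simps)
  moreover obtain \<sigma> where
    "x (Suc (kbar + k)) = cycle_iterate ip f \<alpha> \<sigma> (x (kbar + k)) CARD('n)"
    using rpccd_sequences_Suc[OF x] by blast
  ultimately have "norm (x (Suc (kbar + k)) - x (kbar + k)) \<le> ?s"
    using cycle_iterate_displacement[OF grad, where n = "CARD('n)" and i = "CARD('n)"] assms
    by simp
  then show ?case
    using IH norm_triangle_ineq[of "x (Suc (kbar + k)) - x (kbar + k)" "x (kbar + k) - x kbar"]
    by (simp add: algebra_simps)
qed simp

lemma lipschitz_on_imp_absolutely_continuous_fun_on:
  assumes "L-lipschitz_on S x"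
  shows "absolutely_continuous_fun_on S x"
  unfolding absolutely_continuous_fun_on_def
proof (intro allI impI)
  fix e :: real assume "0 < e"
  have "0 \<le> L"
    using assms by (rule lipschitz_on_nonneg)
  show "\<exists>\<delta>>0. \<forall>(m::nat) a b. (\<forall>j<m. a j \<le> b j \<and> {a j..b j} \<subseteq> S) \<and>
      disjoint_family_on (\<lambda>j. {a j<..<b j}) {..<m} \<and> (\<Sum>j<m. b j - a j) < \<delta> \<longrightarrow>
      (\<Sum>j<m. norm (x (b j) - x (a j))) < e"
  proof (intro exI[of _ "e / (L + 1)"] conjI allI impI)
    show "0 < e / (L + 1)"
      using \<open>0 < e\<close> \<open>0 \<le> L\<close> by simp
    fix m :: nat and a b :: "nat \<Rightarrow> real"
    assume *: "(\<forall>j<m. a j \<le> b j \<and> {a j..b j} \<subseteq> S) \<and>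
      disjoint_family_on (\<lambda>j. {a j<..<b j}) {..<m} \<and> (\<Sum>j<m. b j - a j) < e / (L + 1)"
    have "(\<Sum>j<m. norm (x (b j) - x (a j))) \<le> (\<Sum>j<m. L * (b j - a j))"
    proof (rule sum_mono)
      fix j assume "j \<in> {..<m}"
      with * have "a j \<le> b j" "a j \<in> S" "b j \<in> S"
        by (simp_all add: subset_iff)
      then show "norm (x (b j) - x (a j)) \<le> L * (b j - a j)"
        using lipschitz_onD[OF assms, of "b j" "a j"] by (auto simp: dist_real_def dist_norm)
    qed
    also have "\<dots> \<le> (L + 1) * (\<Sum>j<m. b j - a j)"
      using * by (auto simp: distrib_right simp flip: sum_distrib_left intro!: sum_nonneg)
    also have "\<dots> < e"
      using * \<open>0 \<le> L\<close> by (simp add: field_simps)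
    finally show "(\<Sum>j<m. norm (x (b j) - x (a j))) < e" .
  qed
qed

section \<open>Approximation by trajectories\<close>

text \<open>One cycle moves by at most \<open>n \<alpha> M\<close>, so up to time \<open>T + \<alpha> \<le> 2 T\<close> the iterates stay within
  distance \<open>1\<close> of \<open>X0\<close>, where \<open>M\<close> bounds the gradient. The claim is uniform in the sequence:
  \<open>xs m\<close> may be the counterexample for the \<open>m\<close>-th step size.\<close>

lemma rpccd_subsequence_approximated:
  fixes f :: "real ^ 'n \<Rightarrow> real" and xs :: "nat \<Rightarrow> nat \<Rightarrow> real ^ 'n"
  assumes ip: "is_inner_product ip" and C1: "continuously_differentiable f"
    and "compact X0" and X0_bound: "\<And>z. z \<in> X0 \<Longrightarrow> norm z \<le> R"
    and grad: "\<And>z. norm z \<le> R + 1 \<Longrightarrow> norm (gradient ip f z) \<le> M" and "0 < M"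
    and T: "T = 1 / (2 * (real CARD('n) * M))"
    and \<alpha>: "\<And>m. 0 < \<alpha> m" "\<And>m. \<alpha> m \<le> T" "\<alpha> \<longlonglongrightarrow> 0"
    and xs: "\<And>m. xs m \<in> rpccd_sequences ip f (\<alpha> m) X0 (kbar m)"
    and "0 < \<epsilon>"
  shows "\<exists>m x. subgradient_trajectory ip f 1 T x \<and> x 0 \<in> X0 \<and>
      (\<forall>k\<in>{kbar m..kbar m + nat \<lfloor>T / \<alpha> m\<rfloor>}.
        induced_norm ip (xs m k - x (real (k - kbar m) * \<alpha> m)) \<le> \<epsilon>)"
proof -
  let ?n = "real CARD('n)" and ?G = "gradient ip f"
  \<comment> \<open>The last grid point before \<open>T\<close> may fall short of it; one extra
    cycle lets the polygon cover all of [0,T].\<close>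
  define K where "K m = Suc (nat \<lfloor>T / \<alpha> m\<rfloor>)" for m
  define X where "X m k = xs m (kbar m + k)" for m k
  have "0 < T"
    using \<open>0 < M\<close> by (simp add: T)
  have floor: "real (nat \<lfloor>T / \<alpha> m\<rfloor>) \<le> T / \<alpha> m" "T / \<alpha> m \<le> real (K m)" for m
    using \<open>0 < T\<close> \<alpha>(1)[of m] unfolding K_def by (simp, simp, linarith)
  have horizon: "T \<le> real (K m) * \<alpha> m" for m
    using floor(2)[of m] \<alpha>(1)[of m] by (simp add: field_simps)
  \<comment> \<open>The extra cycle costs at most \<alpha> \<le> T. The factor 2 in the choice of
    \<open>T\<close> absorbs it, so the total displacement is at most 1.\<close>
  have "real (K m) * \<alpha> m \<le> 2 * T" for m
    using floor(1)[of m] \<alpha>(1,2)[of m] unfolding K_def of_nat_Suc pos_le_divide_eq[OF \<alpha>(1)]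
    by (simp only: distrib_right)
  then have budget: "real (K m) * (?n * (\<alpha> m * M)) \<le> 1" for m
    using mult_right_mono[of "real (K m) * \<alpha> m" "2 * T" "?n * M"] \<open>0 < M\<close>
    by (simp add: T mult_ac)
  have start: "X m 0 \<in> X0" for m
    using xs[of m] by (simp add: X_def rpccd_sequences_def)
  have step_nonneg: "0 \<le> \<alpha> m" for m
    using \<alpha>(1)[of m] by simp
  have total: "norm (X m k - X m 0) \<le> real k * (?n * (\<alpha> m * M))" if "k \<le> K m" for m k
    unfolding X_def add_0_right
  proof (rule rpccd_sequences_displacement[OF grad xs])
    show "norm (xs m (kbar m)) + real (K m) * (?n * (\<alpha> m * M)) \<le> R + 1"
      using X0_bound[OF start[of m]] budget[of m] by (simp add: X_def)
  qed (use that \<open>0 < M\<close> step_nonneg in auto)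
  \<comment> \<open>Before each of the \<open>K m\<close> cycles there is still room for a full
    cycle inside the ball of radius R + 1, so its inner iterates obey the gradient bound
    too.\<close>
  have room: "norm (X m k) + ?n * (\<alpha> m * M) \<le> R + 1" if "k < K m" for m k
  proof -
    have "(real k + 1) * (?n * (\<alpha> m * M)) \<le> real (K m) * (?n * (\<alpha> m * M))"
      using that \<open>0 < M\<close> step_nonneg by (intro mult_right_mono) auto
    moreover have "norm (X m k) \<le> norm (X m 0) + norm (X m k - X m 0)"
      using norm_triangle_ineq[of "X m 0" "X m k - X m 0"] by simp
    ultimately show ?thesis
      using total[of k m] that X0_bound[OF start[of m]] budget[of m] by (simp add: algebra_simps)
  qed
  have "\<forall>m k. \<exists>\<sigma>. bij_betw \<sigma> {1..CARD('n)} UNIV \<and>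
      X m (Suc k) = cycle_iterate ip f (\<alpha> m) \<sigma> (X m k) CARD('n)"
    using rpccd_sequences_Suc[OF xs] by (simp add: X_def)
  then obtain \<sigma> where \<sigma>: "\<And>m k. bij_betw (\<sigma> m k) {1..CARD('n)} (UNIV :: 'n set)"
    and Suc: "\<And>m k. X m (Suc k) = cycle_iterate ip f (\<alpha> m) (\<sigma> m k) (X m k) CARD('n)"
    unfolding choice_iff by auto
  have inner: "norm (cycle_iterate ip f (\<alpha> m) (\<sigma> m k) (X m k) i - X m k) \<le> real i * (\<alpha> m * M)"
    if "k < K m" "i \<le> CARD('n)" for m k i
    using room[OF that(1)] that(2) \<open>0 < M\<close> step_nonneg
    by (intro cycle_iterate_displacement[OF grad]) auto
  have incr: "norm (X m (Suc k) - X m k) \<le> \<alpha> m * (?n * M)" if "k < K m" for m k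
    using inner[OF that order_refl] by (simp add: Suc mult_ac)
  have consistent: "\<forall>\<^sub>F m in sequentially. \<forall>k<K m.
        norm (X m (Suc k) - X m k + \<alpha> m *\<^sub>R ?G (X m k)) \<le> \<alpha> m * e" if "0 < e" for e
  proof -
    have "uniformly_continuous_on (cball 0 (R + 1)) ?G"
      by (intro compact_uniformly_continuous continuous_on_gradient ip C1 compact_cball)
    then obtain d where "0 < d" and d: "\<And>u v. norm u \<le> R + 1 \<Longrightarrow> norm v \<le> R + 1 \<Longrightarrow>
        norm (u - v) < d \<Longrightarrow> norm (?G u - ?G v) < e / ?n"
      using \<open>0 < e\<close> unfolding uniformly_continuous_on_def
      by (metis divide_pos_pos dist_norm mem_cball_0 of_nat_0_less_iff zero_less_card_finite)
    have "(\<lambda>m. ?n * (\<alpha> m * M)) \<longlonglongrightarrow> ?n * (0 * M)"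
      by (intro tendsto_intros \<alpha>(3))
    then have "\<forall>\<^sub>F m in sequentially. ?n * (\<alpha> m * M) < d"
      using \<open>0 < d\<close> by (intro order_tendstoD(2)) auto
    then show ?thesis
    proof (eventually_elim, intro allI impI)
      fix m k assume small: "?n * (\<alpha> m * M) < d" and k: "k < K m"
      let ?z = "cycle_iterate ip f (\<alpha> m) (\<sigma> m k) (X m k)"
      have "norm (?G (?z i) - ?G (X m k)) \<le> e / ?n" if "i < CARD('n)" for i
      proof -
        have "norm (?z i - X m k) \<le> ?n * (\<alpha> m * M)"
          by (rule order_trans[OF inner[OF k]])
            (use that \<open>0 < M\<close> step_nonneg in \<open>auto intro!: mult_right_mono\<close>)
        moreover have "0 \<le> ?n * (\<alpha> m * M)"
          using \<open>0 < M\<close> step_nonneg by simp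
        ultimately show ?thesis
          using small room[OF k] norm_triangle_ineq[of "X m k" "?z i - X m k"]
          by (intro less_imp_le[OF d]) auto
      qed
      then have "norm (X m (Suc k) - X m k + \<alpha> m *\<^sub>R ?G (X m k)) \<le> \<alpha> m * (?n * (e / ?n))"
        unfolding Suc by (intro cycle_iterate_consistent \<sigma> step_nonneg)
      then show "norm (X m (Suc k) - X m k + \<alpha> m *\<^sub>R ?G (X m k)) \<le> \<alpha> m * e"
        by simp
    qed
  qed
  have nonneg: "0 \<le> ?n * M" "0 \<le> T"
    using \<open>0 < M\<close> \<open>0 < T\<close> by simp_all
  obtain y r where "strict_mono (r :: nat \<Rightarrow> nat)"
    and deriv: "\<And>t. t \<in> {0..T} \<Longrightarrow> (y has_vector_derivative - ?G (y t)) (at t within {0..T})"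
    and lipschitz: "(?n * M)-lipschitz_on {0..T} y"
    and y0: "(\<lambda>m. X (r m) 0) \<longlonglongrightarrow> y 0"
    and uniform: "\<And>e. 0 < e \<Longrightarrow> \<forall>\<^sub>F m in sequentially. \<forall>k. real k * \<alpha> (r m) \<le> T \<longrightarrow>
          norm (X (r m) k - y (real k * \<alpha> (r m))) < e"
    by (rule inexact_euler_limit[OF continuous_on_gradient[OF ip C1] \<alpha>(1,3) horizon
          X0_bound[OF start] incr consistent nonneg]) (assumption | rule that)+
  have "y 0 \<in> X0"
    using closed_sequentially[OF compact_imp_closed[OF \<open>compact X0\<close>] _ y0] start by blast
  have "subgradient_trajectory ip f 1 T y"
    unfolding subgradient_trajectory_def
  proof (intro conjI AE_I2 impI)
    show "absolutely_continuous_fun_on {0..T} y"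
      using lipschitz by (rule lipschitz_on_imp_absolutely_continuous_fun_on)
    show "\<exists>s\<in>clarke_subdifferential ip f (y t).
        (y has_vector_derivative - (1 *\<^sub>R s)) (at t within {0..T})" if "t \<in> {0..T}" for t
      using deriv[OF that] gradient_in_clarke_subdifferential
        [OF has_derivative_gradient[OF ip C1] is_inner_product_bilinear[OF ip]]
      by auto
  qed
  obtain B where "0 < B" and B: "\<And>v. induced_norm ip v \<le> B * norm v"
    using induced_norm_bounded[OF is_inner_product_bilinear[OF ip]] by blast
  obtain m where m: "\<And>k. real k * \<alpha> (r m) \<le> T \<Longrightarrow>
      norm (X (r m) k - y (real k * \<alpha> (r m))) < \<epsilon> / B"
    using eventually_happens'[OF sequentially_bot uniform[of "\<epsilon> / B"]] \<open>0 < \<epsilon>\<close> \<open>0 < B\<close> by auto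
  have "induced_norm ip (xs (r m) k - y (real (k - kbar (r m)) * \<alpha> (r m))) \<le> \<epsilon>"
    if k: "k \<in> {kbar (r m)..kbar (r m) + nat \<lfloor>T / \<alpha> (r m)\<rfloor>}" for k
  proof -
    let ?j = "k - kbar (r m)"
    have "real ?j \<le> T / \<alpha> (r m)"
      using k by (intro order_trans[OF _ floor(1)]) auto
    then have "norm (xs (r m) k - y (real ?j * \<alpha> (r m))) \<le> \<epsilon> / B"
      using m[of ?j] k \<alpha>(1)[of "r m"] by (simp add: X_def field_simps less_imp_le)
    then show ?thesis
      using B[of "xs (r m) k - y (real ?j * \<alpha> (r m))"] \<open>0 < B\<close>
      by (simp add: pos_le_divide_eq mult.commute)
  qed
  with \<open>subgradient_trajectory ip f 1 T y\<close> \<open>y 0 \<in> X0\<close> show ?thesis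
    by blast
qed

theorem proposition2:
  fixes f :: "real ^ 'n \<Rightarrow> real"
    and ip :: "real ^ 'n \<Rightarrow> real ^ 'n \<Rightarrow> real"
  assumes "is_inner_product ip"
    and "continuously_differentiable f"
  shows "approximated_by_subgradient_trajectories ip f (rpccd_sequences ip f)"
  unfolding approximated_by_subgradient_trajectories_def
\<comment> \<open>The constant is c = 1, as a full cycle amounts to one gradient step of size
  \<alpha>.\<close>
proof (rule exI[of _ 1], intro conjI allI impI)
  fix X0 X1 :: "(real ^ 'n) set"
  assume "compact X0 \<and> compact X1"
  then have "compact X0"
    by simp
  then obtain R where R: "\<And>z. z \<in> X0 \<Longrightarrow> norm z \<le> R"
    using compact_imp_bounded bounded_iff by metis
  have "bounded (gradient ip f ` cball 0 (R + 1))"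
    by (intro compact_imp_bounded compact_continuous_image continuous_on_gradient assms compact_cball)
  then obtain M where "0 < M"
    and M: "\<And>z. norm z \<le> R + 1 \<Longrightarrow> norm (gradient ip f z) \<le> M"
    unfolding bounded_pos by auto
  \<comment> \<open>\<open>R\<close>, \<open>M\<close> and hence \<open>T\<close> depend only on
    \<open>f\<close>, \<open>ip\<close> and X0, so \<open>T\<close> is fixed before
    \<epsilon>.\<close>
  define T where "T = 1 / (2 * (real CARD('n) * M))"
  define good where "good \<epsilon> \<alpha> kbar xs \<longleftrightarrow> (\<exists>x. subgradient_trajectory ip f 1 T x \<and> x 0 \<in> X0 \<and>
      (\<forall>k\<in>{kbar..kbar + nat \<lfloor>T / \<alpha>\<rfloor>}.
        induced_norm ip (xs k - x (real (k - kbar) * \<alpha>)) \<le> \<epsilon>))" for \<epsilon> \<alpha> kbar xs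
  have "0 < T"
    using \<open>0 < M\<close> by (simp add: T_def)
  have "\<exists>\<alpha>bar>0. \<forall>\<alpha>\<in>{0<..\<alpha>bar}. \<forall>kbar. \<forall>xs\<in>rpccd_sequences ip f \<alpha> X0 kbar.
      (\<forall>k\<le>kbar. xs k \<in> X1) \<longrightarrow> good \<epsilon> \<alpha> kbar xs"
    if "0 < \<epsilon>" for \<epsilon>
  proof (rule ccontr)
    assume contra: "\<not> ?thesis"
    \<comment> \<open>The candidate thresholds min(T, 1/(m+1)) all fail. They force the bad step
      sizes to tend to 0 while staying below \<open>T\<close>, as the compactness argument
      requires.\<close>
    then have "\<exists>\<alpha> kbar xs. 0 < \<alpha> \<and> \<alpha> \<le> min T (1 / real (Suc m)) \<and>
        xs \<in> rpccd_sequences ip f \<alpha> X0 kbar \<and> \<not> good \<epsilon> \<alpha> kbar xs" for m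
    proof -
      have "0 < min T (1 / real (Suc m))"
        using \<open>0 < T\<close> by simp
      with contra show ?thesis
        by (meson greaterThanAtMost_iff)
    qed
    then obtain \<alpha> kbar xs where bad: "\<And>m. 0 < \<alpha> m" "\<And>m. \<alpha> m \<le> min T (1 / real (Suc m))"
      "\<And>m. xs m \<in> rpccd_sequences ip f (\<alpha> m) X0 (kbar m)" "\<And>m. \<not> good \<epsilon> (\<alpha> m) (kbar m) (xs m)"
      by metis
    have "\<alpha> \<longlonglongrightarrow> 0"
      by (rule tendsto_sandwich[OF _ _ tendsto_const LIMSEQ_Suc[OF lim_1_over_n]])
        (use bad(1,2) in \<open>auto intro!: always_eventually simp: less_imp_le\<close>)
    then have "\<exists>m. good \<epsilon> (\<alpha> m) (kbar m) (xs m)"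
      unfolding good_def using bad(1,2,3)
      by (intro rpccd_subsequence_approximated[OF assms \<open>compact X0\<close> R M \<open>0 < M\<close> T_def _ _ _ _ that])
        auto
    with bad(4) show False
      by blast
  qed
  with \<open>0 < T\<close> show "\<exists>T>0. \<forall>\<epsilon>>0. \<exists>\<alpha>bar>0. \<forall>\<alpha>\<in>{0<..\<alpha>bar}. \<forall>kbar.
      \<forall>xs\<in>rpccd_sequences ip f \<alpha> X0 kbar. (\<forall>k\<le>kbar. xs k \<in> X1) \<longrightarrow>
      (\<exists>x. subgradient_trajectory ip f 1 T x \<and> x 0 \<in> X0 \<and>
        (\<forall>k\<in>{kbar..kbar + nat \<lfloor>T / \<alpha>\<rfloor>}.
          induced_norm ip (xs k - x (real (k - kbar) * \<alpha>)) \<le> \<epsilon>))"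
    unfolding good_def by (intro exI[of _ T]) simp
qed simp

end
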